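(* Let $\mathcal{C}$ be a finite category and let $B\subseteq\mathrm{Ob}(\mathcal{C})$. Then $B$ is winning for the categorical query game on $\mathcal{C}$ if and only if $B$ is both a cardinal separator and a separator.
   Context: A finite category has finitely many objects and morphisms. Categorical query game on $\mathcal{C}$ with set of test objects $B\subseteq\mathrm{Ob}(\mathcal{C})$: one player secretly chooses a morphism $f\colon x\to y$ of $\mathcal{C}$. In the first phase the opponent is told, for each $b\in B$, the cardinalities $|\mathrm{Hom}(b,x)|$ and $|\mathrm{Hom}(b,y)|$; the game proceeds only if these data determine $x$ and $y$. In the second phase the opponent is told, for each $b\in B$ and each morphism $h\colon b\to x$, the composite $f\circ h$. The set $B$ is winning if the opponent can always determine the secret morphism uniquely. Explicitly, $B$ is winning if for all morphisms $f\colon x\to y$ and $f'\colon x'\to y'$ of $\mathcal{C}$: (i) if $|\mathrm{Hom}(b,x)|=|\mathrm{Hom}(b,x')|$ and $|\mathrm{Hom}(b,y)|=|\mathrm{Hom}(b,y')|$ for all $b\in B$, then $x=x'$ and $y=y'$; and (ii) if $x=x'$, $y=y'$ and $f\circ h=f'\circ h$ for all $b\in B$ and all $h\colon b\to x$, then $f=f'$. $B$ is a cardinal separator if the map $x\mapsto(|\mathrm{Hom}(b,x)|)_{b\in B}$ is injective on objects of $\mathcal{C}$. $B$ is a separator if for every pair of distinct parallel morphisms $f,g\colon x\to y$ there exist $b\in B$ and $h\colon b\to x$ with $f\circ h\neq g\circ h$. *)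

theory Defs
  imports "HOL-Library.FuncSet"
begin

text \<open>
  \<open>Comp C g f\<close> is "g after f"; it is constrained only when the codomain of f is the domain of g.
\<close>

record ('o, 'm) precategory =
  Ob :: "'o set"
  Mor :: "'m set"
  Dom :: "'m \<Rightarrow> 'o"
  Cod :: "'m \<Rightarrow> 'o"
  Ident :: "'o \<Rightarrow> 'm"
  Comp :: "'m \<Rightarrow> 'm \<Rightarrow> 'm"

definition Hom :: "('o, 'm) precategory \<Rightarrow> 'o \<Rightarrow> 'o \<Rightarrow> 'm set" where
  "Hom C x y = {f \<in> Mor C. Dom C f = x \<and> Cod C f = y}"

locale category =
  fixes C :: "('o, 'm) precategory"
  assumes dom_in_Ob: "f \<in> Mor C \<Longrightarrow> Dom C f \<in> Ob C"
    and cod_in_Ob: "f \<in> Mor C \<Longrightarrow> Cod C f \<in> Ob C"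
    and ident_in_Hom: "x \<in> Ob C \<Longrightarrow> Ident C x \<in> Hom C x x"
    and comp_in_Hom: "\<lbrakk>f \<in> Hom C x y; g \<in> Hom C y z\<rbrakk> \<Longrightarrow> Comp C g f \<in> Hom C x z"
    and comp_ident_right: "f \<in> Hom C x y \<Longrightarrow> Comp C f (Ident C x) = f"
    and comp_ident_left: "f \<in> Hom C x y \<Longrightarrow> Comp C (Ident C y) f = f"
    and comp_assoc:
      "\<lbrakk>f \<in> Hom C w x; g \<in> Hom C x y; h \<in> Hom C y z\<rbrakk>
        \<Longrightarrow> Comp C h (Comp C g f) = Comp C (Comp C h g) f"

locale finite_category = category +
  assumes finite_Ob: "finite (Ob C)"
    and finite_Mor: "finite (Mor C)"

text \<open>
  The two conjuncts correspond to the two phases of the categorical query game: the data of the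
  first phase determine the domain and codomain of the secret morphism, and the data of the second
  phase then determine the morphism itself.
\<close>

definition winning :: "('o, 'm) precategory \<Rightarrow> 'o set \<Rightarrow> bool" where
  "winning C B \<longleftrightarrow>
    (\<forall>x\<in>Ob C. \<forall>y\<in>Ob C. \<forall>x'\<in>Ob C. \<forall>y'\<in>Ob C. \<forall>f\<in>Hom C x y. \<forall>f'\<in>Hom C x' y'.
      ((\<forall>b\<in>B. card (Hom C b x) = card (Hom C b x') \<and> card (Hom C b y) = card (Hom C b y'))
        \<longrightarrow> x = x' \<and> y = y') \<and>
      (x = x' \<and> y = y' \<and> (\<forall>b\<in>B. \<forall>h\<in>Hom C b x. Comp C f h = Comp C f' h)
        \<longrightarrow> f = f'))"

definition cardinal_separator :: "('o, 'm) precategory \<Rightarrow> 'o set \<Rightarrow> bool" where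
  "cardinal_separator C B \<longleftrightarrow> inj_on (\<lambda>x. \<lambda>b\<in>B. card (Hom C b x)) (Ob C)"

definition separator :: "('o, 'm) precategory \<Rightarrow> 'o set \<Rightarrow> bool" where
  "separator C B \<longleftrightarrow>
    (\<forall>x\<in>Ob C. \<forall>y\<in>Ob C. \<forall>f\<in>Hom C x y. \<forall>g\<in>Hom C x y. f \<noteq> g \<longrightarrow>
      (\<exists>b\<in>B. \<exists>h\<in>Hom C b x. Comp C f h \<noteq> Comp C g h))"

end

theory Submission
  imports Defs
begin

text \<open>The two phases of the game decouple. Phase one speaks only of objects: the cardinal
  separator property, applied to domain and codomain separately, settles it, and conversely the
  identities make every object an endpoint of some secret
  (\<open>winning_imp_cardinal_separator\<close>). Phase two, for parallel morphisms, is the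
  contrapositive of \<open>separator\<close>.\<close>

lemma cardinal_separator_iff:
  "cardinal_separator C B \<longleftrightarrow>
    (\<forall>x\<in>Ob C. \<forall>x'\<in>Ob C. (\<forall>b\<in>B. card (Hom C b x) = card (Hom C b x')) \<longrightarrow> x = x')"
proof -
  have "(\<lambda>b\<in>B. card (Hom C b x)) = (\<lambda>b\<in>B. card (Hom C b x')) \<longleftrightarrow>
      (\<forall>b\<in>B. card (Hom C b x) = card (Hom C b x'))" for x x'
    \<comment> \<open>Outside \<open>B\<close> both restrictions take the value
      \<open>undefined\<close>, so they can differ only on \<open>B\<close>.\<close>
    by (auto simp: fun_eq_iff restrict_def)
  then show ?thesis
    by (simp add: cardinal_separator_def inj_on_def)
qed

lemma (in category) winning_imp_cardinal_separator:
  assumes "winning C B"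
  shows "cardinal_separator C B"
  unfolding cardinal_separator_iff
proof (intro ballI impI)
  fix x x'
  assume x: "x \<in> Ob C" and x': "x' \<in> Ob C"
    and eq: "\<forall>b\<in>B. card (Hom C b x) = card (Hom C b x')"
  \<comment> \<open>play the game with the two identities as candidate secrets\<close>
  show "x = x'"
    using assms[unfolded winning_def, rule_format, THEN conjunct1, THEN mp,
        OF x x x' x' ident_in_Hom[OF x] ident_in_Hom[OF x']] eq
    by simp
qed

lemma winning_imp_separator:
  assumes "winning C B"
  shows "separator C B"
  unfolding separator_def
proof (intro ballI impI)
  fix x y f g
  assume x: "x \<in> Ob C" and y: "y \<in> Ob C"
    and f: "f \<in> Hom C x y" and g: "g \<in> Hom C x y" and "f \<noteq> g"
  then show "\<exists>b\<in>B. \<exists>h\<in>Hom C b x. Comp C f h \<noteq> Comp C g h"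
    \<comment> \<open>Both candidate secrets get the same endpoints, so only agreement on all probes
      \<open>h\<close> remains to be refuted.\<close>
    using assms[unfolded winning_def, rule_format, THEN conjunct2, THEN mp, OF x y x y f g]
    by auto
qed

lemma separators_imp_winning:
  assumes "cardinal_separator C B" and "separator C B"
  shows "winning C B"
  unfolding winning_def
proof (intro ballI conjI impI)
  fix x y x' y' f f'
  assume ob: "x \<in> Ob C" "y \<in> Ob C" "x' \<in> Ob C" "y' \<in> Ob C"
    and f: "f \<in> Hom C x y" and f': "f' \<in> Hom C x' y'"
  {
    assume "\<forall>b\<in>B. card (Hom C b x) = card (Hom C b x') \<and> card (Hom C b y) = card (Hom C b y')"
    then show "x = x'" and "y = y'"
      using assms(1) ob by (simp_all add: cardinal_separator_iff)
  next
    assume "x = x' \<and> y = y' \<and> (\<forall>b\<in>B. \<forall>h\<in>Hom C b x. Comp C f h = Comp C f' h)"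
    then show "f = f'"
      \<comment> \<open>The equal endpoints make \<open>f\<close> and \<open>f'\<close> parallel, so
        a separating probe would contradict their agreement.\<close>
      using assms(2) ob f f' unfolding separator_def by blast
  }
qed

theorem theorem6p3:
  fixes C :: "('o, 'm) precategory" and B :: "'o set"
  assumes "finite_category C"
    and "B \<subseteq> Ob C"
  shows "winning C B \<longleftrightarrow> cardinal_separator C B \<and> separator C B"
proof -
  interpret finite_category C by fact
  show ?thesis
    by (metis winning_imp_cardinal_separator winning_imp_separator separators_imp_winning)
qed

end
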